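(* Let $M>\frac23$. For every $\alpha\in\mathbb{R}$ the equation $T_{\rm Biot}(U)=\alpha\,\mathbb{1}$, where $T_{\rm Biot}$ is the Biot stress tensor of the compressible Neo-Hooke-Ciarlet-Geymonat material with parameter $M$, has a unique radial solution $U=\beta^+\,\mathbb{1}$, $\beta^+>0$. Moreover, the mapping $$f_{\rm Biot}:(0,\infty)\to\mathbb{R},\qquad f_{\rm Biot}(\beta)=\frac{(3M-2)\,\beta^6+6\,\beta^2-4-3M}{6\,\beta},$$ which satisfies $T_{\rm Biot}(\beta\,\mathbb{1})=f_{\rm Biot}(\beta)\,\mathbb{1}$, is strictly monotone increasing, continuous and surjective, and the solution $\beta^+=\beta^+(\alpha)$ is a monotone increasing function of $\alpha$.
   Context: $\mathrm{Sym}^{++}(3)$ is the set of real symmetric positive definite $3\times3$ matrices, $\mathbb{1}$ the $3\times3$ identity matrix. For $M>\frac23$, the Biot stress tensor of the (one-parameter) Neo-Hooke-Ciarlet-Geymonat energy $\frac12\|U\|^2-\log\det U+\left(\frac M4-\frac16\right)\left((\det U)^2-2\log\det U-1\right)$ is, for $U\in\mathrm{Sym}^{++}(3)$, $$T_{\rm Biot}(U)=U+\Big[\Big(\tfrac M2-\tfrac13\Big)\Big(\det U-\tfrac1{\det U}\Big)-\tfrac1{\det U}\Big](\det U)\,U^{-1}.$$ A radial solution is a solution of the form $U=\beta^+\mathbb{1}$ with $\beta^+>0$; "unique radial solution" means that there is exactly one such $\beta^+$. *)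

theory Defs
  imports "HOL-Analysis.Analysis"
begin

definition Sym_pp3 :: "(real^3^3) set" where
  "Sym_pp3 = {U. transpose U = U \<and> (\<forall>x. x \<noteq> 0 \<longrightarrow> x \<bullet> (U *v x) > 0)}"

text \<open>The derivative \<open>D\<^sub>U W\<close> of the Neo-Hooke-Ciarlet-Geymonat energy
  \<open>W(U) = 1/2 \<parallel>U\<parallel>\<^sup>2 - ln (det U) + (M/4 - 1/6) ((det U)\<^sup>2 - 2 ln (det U) - 1)\<close>
  with respect to the Frobenius inner product. It is meaningful only for \<open>U\<close> in
  \<open>Sym_pp3\<close>, where \<open>det U > 0\<close> and \<open>matrix_inv U\<close> is the inverse of \<open>U\<close>.\<close>

definition T_Biot :: "real \<Rightarrow> real^3^3 \<Rightarrow> real^3^3" where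
  "T_Biot M U =
     U + (((M/2 - 1/3) * (det U - 1 / det U) - 1 / det U) * det U) *\<^sub>R matrix_inv U"

definition Biot_solution :: "real \<Rightarrow> real \<Rightarrow> real^3^3 \<Rightarrow> bool" where
  "Biot_solution M \<alpha> U \<longleftrightarrow> U \<in> Sym_pp3 \<and> T_Biot M U = \<alpha> *\<^sub>R mat 1"

definition radial_solution :: "real \<Rightarrow> real \<Rightarrow> real \<Rightarrow> bool" where
  "radial_solution M \<alpha> \<beta> \<longleftrightarrow> \<beta> > 0 \<and> Biot_solution M \<alpha> (\<beta> *\<^sub>R mat 1)"

text \<open>Meaningful when there is exactly one radial solution.\<close>

definition beta_plus :: "real \<Rightarrow> real \<Rightarrow> real" where
  "beta_plus M \<alpha> = (THE \<beta>. radial_solution M \<alpha> \<beta>)"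

definition f_Biot :: "real \<Rightarrow> real \<Rightarrow> real" where
  "f_Biot M \<beta> = ((3 * M - 2) * \<beta>^6 + 6 * \<beta>^2 - 4 - 3 * M) / (6 * \<beta>)"

end

theory Submission
  imports Defs
begin

text \<open>On positive multiples of the identity the tensor equation collapses to the scalar
  equation \<open>f_Biot M b = \<alpha>\<close> (\<open>radial_solution_iff\<close>). For M > 2/3,
  \<open>f_Biot_split\<close> writes f as a sum of increasing terms in b^5, b and -1/b. So f is
  strictly increasing; it falls below every real near 0 and exceeds every real for large b, hence is
  onto by the intermediate value theorem. Thus \<open>beta_plus M\<close> is the inverse of f and
  increases with it.\<close>

lemma det_scaleR_mat_1: "det (b *\<^sub>R mat 1 :: real^'n^'n) = b ^ CARD('n)"
  by (subst det_diagonal) (auto simp: mat_def)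

text \<open>\<open>matrix_inv\<close> is a Hilbert choice, so uniqueness is needed: multiplying by b
  times the identity on either side scales by b, which leaves one candidate.\<close>

lemma matrix_inv_scaleR_mat_1:
  fixes b :: real
  assumes "b \<noteq> 0"
  shows "matrix_inv (b *\<^sub>R mat 1 :: real^'n^'n) = inverse b *\<^sub>R mat 1"
proof -
  have inv: "(b *\<^sub>R mat 1) ** A = b *\<^sub>R A" "A ** (b *\<^sub>R mat 1) = b *\<^sub>R A"
    for A :: "real^'n^'n"
    by (simp_all add: scalar_matrix_assoc[symmetric] matrix_scalar_ac)
  have "A = inverse b *\<^sub>R mat 1" if "b *\<^sub>R A = mat 1" for A :: "real^'n^'n"
    unfolding that[symmetric] using assms by simp
  then show ?thesis
    unfolding matrix_inv_def inv by (intro some_equality) (use assms in auto)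
qed

lemma scaleR_mat_1_mult_vec: "(b *\<^sub>R mat 1 :: real^'n^'n) *v x = b *\<^sub>R x"
  by (simp add: scaleR_matrix_vector_assoc[symmetric])

lemma scaleR_mat_1_in_Sym_pp3:
  assumes "b > 0"
  shows "b *\<^sub>R mat 1 \<in> Sym_pp3"
  using assms by (auto simp: Sym_pp3_def scaleR_mat_1_mult_vec transpose_scalar)

lemma T_Biot_radial:
  assumes "b > 0"
  shows "T_Biot M (b *\<^sub>R mat 1) = f_Biot M b *\<^sub>R mat 1"
proof -
  have "b + ((M/2 - 1/3) * (b^3 - 1 / b^3) - 1 / b^3) * b^3 * inverse b = f_Biot M b"
    using assms by (simp add: f_Biot_def field_simps eval_nat_numeral)
  then show ?thesis
    using assms unfolding T_Biot_def det_scaleR_mat_1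
    by (simp add: matrix_inv_scaleR_mat_1 flip: scaleR_left.add)
qed

lemma radial_solution_iff: "radial_solution M \<alpha> b \<longleftrightarrow> b > 0 \<and> f_Biot M b = \<alpha>"
proof -
  have "f_Biot M b *\<^sub>R (mat 1 :: real^3^3) = \<alpha> *\<^sub>R mat 1 \<longleftrightarrow> f_Biot M b = \<alpha>"
    \<comment> \<open>A diagonal entry recovers the scalar; cancellation would add the disjunct that
      the identity matrix is zero.\<close>
    by (auto simp: mat_def vec_eq_iff simp del: scaleR_cancel_right)
  then show ?thesis
    unfolding radial_solution_def Biot_solution_def
    using T_Biot_radial[of b M] scaleR_mat_1_in_Sym_pp3[of b] by auto
qed

lemma f_Biot_split:
  assumes "b \<noteq> 0"
  shows "f_Biot M b = (M/2 - 1/3) * b^5 + b - (M/2 + 2/3) / b"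
  using assms by (simp add: f_Biot_def field_simps eval_nat_numeral)

text \<open>Both coefficients in \<open>f_Biot_split\<close> are positive, so the outer terms do not
  decrease; the linear term gives strictness.\<close>

lemma strict_mono_on_f_Biot:
  assumes "M > 2/3"
  shows "strict_mono_on {0<..} (f_Biot M)"
proof (rule strict_mono_onI)
  fix a b :: real
  assume ab: "a \<in> {0<..}" "b \<in> {0<..}" "a < b"
  have "(M/2 - 1/3) * a^5 \<le> (M/2 - 1/3) * b^5"
    using assms ab by (intro mult_left_mono power_mono) auto
  moreover have "(M/2 + 2/3) / b \<le> (M/2 + 2/3) / a"
    using assms ab by (intro divide_left_mono) auto
  ultimately show "f_Biot M a < f_Biot M b"
    using ab by (simp add: f_Biot_split)
qed

lemma continuous_on_f_Biot: "continuous_on {0<..} (f_Biot M)"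
  unfolding f_Biot_def by (intro continuous_intros) auto

lemma surj_f_Biot:
  assumes "M > 2/3"
  shows "f_Biot M ` {0<..} = UNIV"
proof -
  have "\<alpha> \<in> f_Biot M ` {0<..}" for \<alpha>
  proof -
    \<comment> \<open>The two coefficients of the split form differ by 1, so they become c - 1 and
      c.\<close>
    define c where "c = M/2 + 2/3"
    define a where "a = c / (\<bar>\<alpha>\<bar> + c)"
    define b where "b = \<bar>\<alpha>\<bar> + c + 1"
    have c: "c > 1" and k: "M/2 - 1/3 = c - 1"
      using assms by (auto simp: c_def)
    have a: "0 < a" "a \<le> 1" and b: "1 \<le> b"
      using c by (auto simp: a_def b_def)
    have split: "f_Biot M x = (c - 1) * x^5 + x - c / x" if "x > 0" for x
      using f_Biot_split[of x M] that unfolding k c_def[symmetric] by simp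
    txt \<open>The power \<open>x^5\<close> is bounded by 1 at \<open>a \<le> 1\<close> and dropped at \<open>b \<ge> 1\<close>;
      \<open>a\<close> and \<open>b\<close> solve the estimates left over.\<close>
    have "f_Biot M a = (c - 1) * a^5 + a - c / a"
      using a by (simp add: split)
    also have "\<dots> \<le> (c - 1) * 1 + 1 - c / a"
      using a c by (intro diff_right_mono add_mono mult_left_mono power_le_one) auto
    also have "c / a = \<bar>\<alpha>\<bar> + c"
      using c by (simp add: a_def)
    finally have fa: "f_Biot M a \<le> \<alpha>"
      by simp
    have "c / b \<le> c" "0 \<le> (c - 1) * b^5"
      using b c by (auto simp: divide_le_eq)
    moreover have "f_Biot M b = (c - 1) * b^5 + b - c / b"
      using b by (simp add: split)
    ultimately have fb: "\<alpha> \<le> f_Biot M b"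
      unfolding b_def by linarith
    have "continuous_on {a..b} (f_Biot M)"
      by (rule continuous_on_subset[OF continuous_on_f_Biot]) (use a in auto)
    then obtain x where "a \<le> x" "f_Biot M x = \<alpha>"
      using IVT'[of "f_Biot M" a \<alpha> b] fa fb a b by auto
    then show ?thesis
      using a by (intro image_eqI[of _ _ x]) auto
  qed
  then show ?thesis
    by blast
qed

lemma ex1_radial_solution:
  assumes "M > 2/3"
  shows "\<exists>!\<beta>. radial_solution M \<alpha> \<beta>"
proof -
  have "inj_on (f_Biot M) {0<..}"
    using strict_mono_on_f_Biot[OF assms] by (rule strict_mono_on_imp_inj_on)
  moreover have "\<alpha> \<in> f_Biot M ` {0<..}"
    by (simp add: surj_f_Biot[OF assms])
  ultimately show ?thesis
    unfolding radial_solution_iff by (auto dest: inj_onD)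
qed

lemma strict_mono_beta_plus:
  assumes "M > 2/3"
  shows "strict_mono (beta_plus M)"
proof (rule strict_monoI)
  fix x y :: real
  assume "x < y"
  \<comment> \<open>Unique existence makes the description \<open>THE\<close> denote a solution, so
    \<open>beta_plus M\<close> is a right inverse of f.\<close>
  have "radial_solution M \<alpha> (beta_plus M \<alpha>)" for \<alpha>
    unfolding beta_plus_def by (rule theI') (rule ex1_radial_solution[OF assms])
  then have beta: "beta_plus M \<alpha> > 0" "f_Biot M (beta_plus M \<alpha>) = \<alpha>" for \<alpha>
    by (auto simp: radial_solution_iff)
  \<comment> \<open>A strictly increasing f also reflects the order.\<close>
  show "beta_plus M x < beta_plus M y"
    using \<open>x < y\<close> beta strict_mono_on_less[OF strict_mono_on_f_Biot[OF assms],
        of "beta_plus M x" "beta_plus M y"]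
    by simp
qed

theorem proposition6p1:
  fixes M :: real
  assumes "M > 2/3"
  shows "(\<forall>\<alpha>. \<exists>!\<beta>. radial_solution M \<alpha> \<beta>)
    \<and> (\<forall>\<beta>>0. T_Biot M (\<beta> *\<^sub>R mat 1) = f_Biot M \<beta> *\<^sub>R mat 1)
    \<and> strict_mono_on {0<..} (f_Biot M)
    \<and> continuous_on {0<..} (f_Biot M)
    \<and> f_Biot M ` {0<..} = UNIV
    \<and> strict_mono (beta_plus M)"
  using ex1_radial_solution T_Biot_radial strict_mono_on_f_Biot continuous_on_f_Biot
    surj_f_Biot strict_mono_beta_plus assms by blast

end
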